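(* Let $a\ge 0$ be a real number, and let $G$ be a connected simple graph with $n=|V(G)|$ vertices and minimum degree $\delta=\delta(G)$. Let $k\in(0,n)$ be a real number with $\delta\le\frac{n-k}{2}$. If $$\lambda_{1}(aD(\overline{G})+A(\overline{G}))<(a+1)(\delta+k-1),$$ then $\mu_{f}(G)>\frac{n-k}{2}$.
   Context: Graphs are finite, simple and undirected. $\overline{G}$ is the complement of $G$. For a graph $H$, $A(H)$ is the adjacency matrix, $D(H)$ is the diagonal matrix of vertex degrees, and $\lambda_1(M)$ denotes the largest eigenvalue of a real symmetric matrix $M$. A fractional matching of $G$ is a function $f:E(G)\to[0,1]$ such that for every vertex $v$ the sum of $f(e)$ over all edges $e$ incident with $v$ is at most $1$. The fractional matching number is $\mu_f(G)=\max\{\sum_{e\in E(G)}f(e): f \text{ is a fractional matching of } G\}$. *)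

theory Defs
  imports "HOL-Analysis.Analysis"
begin

text \<open>
  A finite simple graph is given by its set of edges, each edge being a two-element set of
  vertices; its vertex set is the whole of a type of class \<open>finite\<close>, so that
  \<open>n = CARD('v)\<close> and vertex-indexed matrices have type \<open>real ^ 'v ^ 'v\<close>.
\<close>

definition simple_graph :: "'v::finite set set \<Rightarrow> bool" where
  "simple_graph E \<longleftrightarrow> (\<forall>e\<in>E. card e = 2)"

definition complement_graph :: "'v::finite set set \<Rightarrow> 'v set set" where
  "complement_graph E = {e. card e = 2 \<and> e \<notin> E}"

definition connected_graph :: "'v::finite set set \<Rightarrow> bool" where
  "connected_graph E \<longleftrightarrow> (\<forall>u v. (u, v) \<in> {(x, y). {x, y} \<in> E}\<^sup>*)"

definition degree :: "'v::finite set set \<Rightarrow> 'v \<Rightarrow> nat" where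
  "degree E v = card {e \<in> E. v \<in> e}"

definition min_degree :: "'v::finite set set \<Rightarrow> nat" where
  "min_degree E = Min (range (degree E))"

definition adjacency_matrix :: "'v::finite set set \<Rightarrow> real ^ 'v ^ 'v" where
  "adjacency_matrix E = (\<chi> i j. if {i, j} \<in> E then 1 else 0)"

definition degree_matrix :: "'v::finite set set \<Rightarrow> real ^ 'v ^ 'v" where
  "degree_matrix E = (\<chi> i j. if i = j then real (degree E i) else 0)"

definition eigenvalues :: "real ^ 'v ^ 'v::finite \<Rightarrow> real set" where
  "eigenvalues M = {l. \<exists>x. x \<noteq> 0 \<and> M *v x = l *\<^sub>R x}"

text \<open>
  \<open>Max\<close> is only specified on finite nonempty sets; the lemmas \<open>finite_eigenvalues\<close> and
  \<open>eigenvalues_nonempty\<close> below show that this is the case for symmetric matrices.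
\<close>

definition lambda1 :: "real ^ 'v ^ 'v::finite \<Rightarrow> real" where
  "lambda1 M = Max (eigenvalues M)"

text \<open>Values of \<open>f\<close> outside the edge set \<open>E\<close> are irrelevant.\<close>

definition fractional_matching :: "'v::finite set set \<Rightarrow> ('v set \<Rightarrow> real) \<Rightarrow> bool" where
  "fractional_matching E f \<longleftrightarrow>
     (\<forall>e\<in>E. 0 \<le> f e \<and> f e \<le> 1) \<and> (\<forall>v. (\<Sum>e\<in>{e \<in> E. v \<in> e}. f e) \<le> 1)"

text \<open>
  The supremum is a maximum, see \<open>fractional_matching_number_attained\<close> and
  \<open>fractional_matching_number_upper\<close>.
\<close>

definition fractional_matching_number :: "'v::finite set set \<Rightarrow> real" where
  "fractional_matching_number E = Sup {(\<Sum>e\<in>E. f e) | f. fractional_matching E f}"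

lemma finite_eigenvalues:
  fixes M :: "real ^ 'v ^ 'v::finite"
  assumes sym: "transpose M = M"
  shows "finite (eigenvalues M)"
proof -
  have "\<forall>l\<in>eigenvalues M. \<exists>x. x \<noteq> 0 \<and> M *v x = l *\<^sub>R x"
    by (auto simp: eigenvalues_def)
  then obtain g where g: "\<And>l. l \<in> eigenvalues M \<Longrightarrow> g l \<noteq> 0 \<and> M *v g l = l *\<^sub>R g l"
    by metis
  have orth: "g l \<bullet> g m = 0" if "l \<in> eigenvalues M" "m \<in> eigenvalues M" "l \<noteq> m" for l m
  proof -
    have "(M *v g l) \<bullet> g m = g l \<bullet> (M *v g m)"
      by (metis sym dot_lmul_matrix transpose_matrix_vector)
    then have "(l - m) * (g l \<bullet> g m) = 0"
      using g[OF that(1)] g[OF that(2)] by (simp add: algebra_simps)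
    then show ?thesis using that(3) by simp
  qed
  have "pairwise orthogonal (g ` eigenvalues M)"
    unfolding pairwise_def orthogonal_def using orth by blast
  moreover have "0 \<notin> g ` eigenvalues M" using g by fastforce
  ultimately have "finite (g ` eigenvalues M)"
    using pairwise_orthogonal_independent independent_bound by blast
  moreover have "inj_on g (eigenvalues M)"
    by (rule inj_onI) (metis g inner_eq_zero_iff orth)
  ultimately show ?thesis by (rule finite_imageD)
qed

lemma eigenvalues_nonempty:
  fixes M :: "real ^ 'v ^ 'v::finite"
  assumes sym: "transpose M = M"
  shows "eigenvalues M \<noteq> {}"
proof -
  have cont: "continuous_on (sphere 0 1) (\<lambda>x. x \<bullet> (M *v x))"
    by (intro continuous_intros)
  have "sphere (0 :: real ^ 'v) 1 \<noteq> {}" by simp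
  then obtain x where x: "norm x = 1"
    and mx: "\<And>y. norm y = 1 \<Longrightarrow> y \<bullet> (M *v y) \<le> x \<bullet> (M *v x)"
    using continuous_attains_sup[OF compact_sphere _ cont] by (auto simp: dist_norm)
  define m where "m = x \<bullet> (M *v x)"
  define B where "B = (\<lambda>y. m *\<^sub>R y - M *v y)"
  have lin: "linear B"
    unfolding B_def by (intro linear_compose_sub linear_scale_self matrix_vector_mul_linear)
  have B_sym: "B y \<bullet> z = y \<bullet> B z" for y z
  proof -
    have "(M *v y) \<bullet> z = y \<bullet> (M *v z)"
      by (metis sym dot_lmul_matrix transpose_matrix_vector)
    then show ?thesis by (simp add: B_def inner_diff_left inner_diff_right)
  qed
  have B_pos: "0 \<le> y \<bullet> B y" for y
  proof (cases "y = 0")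
    case False
    define z where "z = y /\<^sub>R norm y"
    have y: "y = norm y *\<^sub>R z" and nz: "norm z = 1" using False by (auto simp: z_def)
    have "z \<bullet> B z = m - z \<bullet> (M *v z)"
      using nz by (simp add: B_def inner_diff_right dot_square_norm)
    then have "0 \<le> z \<bullet> B z" using mx[OF nz] by (simp add: m_def)
    moreover have "y \<bullet> B y = (norm y)\<^sup>2 * (z \<bullet> B z)"
      by (subst (1 2) y) (simp add: linear_scale[OF lin] power2_eq_square)
    ultimately show ?thesis by simp
  qed simp
  have x0: "x \<bullet> B x = 0"
    using x by (simp add: B_def m_def inner_diff_right dot_square_norm)
  define z where "z = B x"
  define c where "c = z \<bullet> B z"
  have "0 \<le> (x - s *\<^sub>R z) \<bullet> B (x - s *\<^sub>R z)" for s by (rule B_pos)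
  moreover have "(x - s *\<^sub>R z) \<bullet> B (x - s *\<^sub>R z) = s * (s * c - 2 * (z \<bullet> z))" for s
    using x0 B_sym[of x z]
    by (simp add: linear_diff[OF lin] linear_scale[OF lin] inner_diff_left inner_diff_right
        c_def z_def[symmetric] inner_commute algebra_simps)
  ultimately have ineq: "0 \<le> s * (s * c - 2 * (z \<bullet> z))" for s by simp
  have c: "0 \<le> c" unfolding c_def by (rule B_pos)
  have "z = 0"
  proof (rule ccontr)
    assume "z \<noteq> 0"
    then have zz: "z \<bullet> z > 0" by simp
    define s where "s = (z \<bullet> z) / (c + 1)"
    have s: "s > 0" using zz c by (simp add: s_def)
    have "s * c \<le> z \<bullet> z" using zz c by (simp add: s_def field_simps)
    then have "s * (s * c - 2 * (z \<bullet> z)) < 0"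
      using s zz by (intro mult_pos_neg) linarith+
    then show False using ineq[of s] by linarith
  qed
  then have "M *v x = m *\<^sub>R x" by (simp add: z_def B_def)
  moreover have "x \<noteq> 0" using x by auto
  ultimately show ?thesis by (auto simp: eigenvalues_def)
qed

lemma transpose_degree_adjacency:
  "transpose (a *\<^sub>R degree_matrix E + adjacency_matrix E) =
    a *\<^sub>R degree_matrix E + adjacency_matrix E"
  by (simp add: vec_eq_iff transpose_def degree_matrix_def adjacency_matrix_def insert_commute)

lemma fractional_matching_maximum_exists:
  fixes E :: "'v::finite set set"
  shows "\<exists>f. fractional_matching E f \<and>
    (\<forall>g. fractional_matching E g \<longrightarrow> (\<Sum>e\<in>E. g e) \<le> (\<Sum>e\<in>E. f e))"
proof -
  define K :: "(real ^ ('v set)) set" where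
    "K = cbox 0 1 \<inter> (\<Inter>v. {x. (\<Sum>e\<in>{e \<in> E. v \<in> e}. x $ e) \<le> 1})"
  have "closed (\<Inter>v. {x :: real ^ ('v set). (\<Sum>e\<in>{e \<in> E. v \<in> e}. x $ e) \<le> 1})"
    by (intro closed_INT ballI closed_Collect_le continuous_intros)
  then have "compact K" unfolding K_def by (intro compact_Int_closed compact_cbox)
  moreover have "0 \<in> K" by (simp add: K_def mem_box_cart)
  moreover have "continuous_on K (\<lambda>x. \<Sum>e\<in>E. x $ e)" by (intro continuous_intros)
  ultimately obtain x where x: "x \<in> K" and mx: "\<And>y. y \<in> K \<Longrightarrow> (\<Sum>e\<in>E. y $ e) \<le> (\<Sum>e\<in>E. x $ e)"
    using continuous_attains_sup[of K "\<lambda>x. \<Sum>e\<in>E. x $ e"] by blast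
  have "fractional_matching E (($) x)"
    using x by (simp add: K_def fractional_matching_def mem_box_cart)
  moreover have "(\<Sum>e\<in>E. g e) \<le> (\<Sum>e\<in>E. x $ e)" if g: "fractional_matching E g" for g
  proof -
    define y where "y = (\<chi> e. if e \<in> E then g e else 0)"
    have eq: "(\<Sum>e\<in>F. y $ e) = (\<Sum>e\<in>F. g e)" if "F \<subseteq> E" for F
      using that by (intro sum.cong) (auto simp: y_def)
    have "y \<in> K"
      using g eq[of "{e \<in> E. _ \<in> e}"]
      by (simp add: K_def mem_box_cart fractional_matching_def) (simp add: y_def)
    from mx[OF this] show ?thesis by (simp add: eq)
  qed
  ultimately show ?thesis by blast
qed

lemma fractional_matching_number_upper:
  assumes "fractional_matching E f"
  shows "(\<Sum>e\<in>E. f e) \<le> fractional_matching_number E"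
proof -
  have "bdd_above {(\<Sum>e\<in>E. f e) | f. fractional_matching E f}"
    using fractional_matching_maximum_exists[of E] by (auto simp: bdd_above_def)
  then show ?thesis
    unfolding fractional_matching_number_def using assms by (intro cSup_upper) auto
qed

lemma fractional_matching_number_attained:
  obtains f where "fractional_matching E f" "(\<Sum>e\<in>E. f e) = fractional_matching_number E"
proof -
  obtain f where f: "fractional_matching E f"
    and mx: "\<And>g. fractional_matching E g \<Longrightarrow> (\<Sum>e\<in>E. g e) \<le> (\<Sum>e\<in>E. f e)"
    using fractional_matching_maximum_exists[of E] by blast
  have "fractional_matching_number E = (\<Sum>e\<in>E. f e)"
    unfolding fractional_matching_number_def using f mx by (intro cSup_eq_maximum) auto
  with f that show ?thesis by simp
qed

end

theory Submission
  imports Defs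
begin

text \<open>
  Hall's theorem with deficiency, applied to the bipartite double cover of the graph, shows that a
  fractional matching number of at most \<open>(n - k) / 2\<close> forces a set \<open>X\<close> of vertices
  with \<open>|X| \<ge> |N(X)| + k\<close>. Discarding \<open>X \<inter> N(X)\<close> from \<open>X\<close>
  leaves an independent set \<open>T\<close> that satisfies the same inequality. As \<open>T\<close> is
  nonempty, \<open>|N(T)| \<ge> \<delta>\<close>, so the complement contains a clique on at least
  \<open>\<delta> + k\<close> vertices. The Rayleigh quotient of its indicator vector bounds
  \<open>\<lambda>\<^sub>1\<close> from below by \<open>(a + 1) (\<delta> + k - 1)\<close>.
\<close>

section \<open>Hall's theorem\<close>

text \<open>
  The induction of Halmos and Vaughan: either a proper nonempty subfamily \<open>J\<close> is tight, and
  then \<open>J\<close> and its complement are matched separately, or one index can be matched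
  arbitrarily.
\<close>

lemma hall_marriage:
  fixes A :: "'i \<Rightarrow> 'b set"
  assumes "finite I" and "\<And>i. i \<in> I \<Longrightarrow> finite (A i)"
    and "\<And>J. J \<subseteq> I \<Longrightarrow> card J \<le> card (\<Union>i\<in>J. A i)"
  shows "\<exists>h. inj_on h I \<and> (\<forall>i\<in>I. h i \<in> A i)"
  using assms
proof (induction "card I" arbitrary: I A rule: less_induct)
  case less
  note finI = less.prems(1) and finA = less.prems(2) and hall = less.prems(3)
  show ?case
  proof (cases "\<exists>J. J \<subset> I \<and> J \<noteq> {} \<and> card (\<Union>i\<in>J. A i) = card J")
    case True
    then obtain J where J: "J \<subset> I" "J \<noteq> {}" and tight: "card (\<Union>i\<in>J. A i) = card J"
      by blast
    define B where "B = (\<Union>i\<in>J. A i)"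
    have finJ: "finite J" using J(1) finI finite_subset by blast
    have finB: "finite B" unfolding B_def using J(1) finA finJ by blast
    have "card J < card I" using J(1) finI by (simp add: psubset_card_mono)
    moreover have "\<And>K. K \<subseteq> J \<Longrightarrow> card K \<le> card (\<Union>i\<in>K. A i)"
      using hall J(1) by blast
    moreover have "\<And>i. i \<in> J \<Longrightarrow> finite (A i)" using finA J(1) by blast
    ultimately have "\<exists>h. inj_on h J \<and> (\<forall>i\<in>J. h i \<in> A i)"
      using less.hyps[of J A, OF _ finJ] by simp
    then obtain h1 where h1: "inj_on h1 J" "\<forall>i\<in>J. h1 i \<in> A i" by blast
    \<comment> \<open>Deleting \<open>B\<close> keeps Hall's condition outside \<open>J\<close>:
      apply the condition to \<open>K \<union> J\<close> and subtract the equality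
      \<open>card B = card J\<close>.\<close>
    have hall2: "card K \<le> card (\<Union>i\<in>K. A i - B)" if K: "K \<subseteq> I - J" for K
    proof -
      have finK: "finite K" using K finI finite_subset by blast
      have finAK: "finite (\<Union>i\<in>K. A i - B)" using K finA finK by blast
      have "card K + card J = card (K \<union> J)"
        using K finK finJ by (subst card_Un_disjoint) auto
      also have "\<dots> \<le> card (\<Union>i\<in>K \<union> J. A i)" using hall K J(1) by blast
      also have "(\<Union>i\<in>K \<union> J. A i) = (\<Union>i\<in>K. A i - B) \<union> B" by (auto simp: B_def)
      also have "card \<dots> = card (\<Union>i\<in>K. A i - B) + card B"
        using finAK finB by (subst card_Un_disjoint) auto
      finally show ?thesis using tight by (simp add: B_def)
    qed
    have "card (I - J) < card I" using J finI by (intro psubset_card_mono) auto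
    then have "\<exists>h. inj_on h (I - J) \<and> (\<forall>i\<in>I - J. h i \<in> A i - B)"
      using less.hyps[of "I - J" "\<lambda>i. A i - B"] finI finA hall2 by simp
    then obtain h2 where h2: "inj_on h2 (I - J)" "\<forall>i\<in>I - J. h2 i \<in> A i - B" by blast
    define h where "h = (\<lambda>i. if i \<in> J then h1 i else h2 i)"
    \<comment> \<open>The two partial matchings take values on opposite sides of \<open>B\<close>,
      so they glue injectively.\<close>
    have "h i \<in> B" if "i \<in> J" for i using that h1(2) by (auto simp: h_def B_def)
    moreover have "h i \<notin> B" if "i \<in> I - J" for i using that h2(2) by (auto simp: h_def)
    ultimately have "inj_on h I"
      using h1(1) h2(1) J(1) unfolding inj_on_def h_def by (metis DiffI)
    moreover have "\<forall>i\<in>I. h i \<in> A i" using h1(2) h2(2) by (auto simp: h_def)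
    ultimately show ?thesis by blast
  next
    case no_tight: False
    show ?thesis
    proof (cases "I = {}")
      case False
      then obtain i where i: "i \<in> I" by blast
      have "card {i} \<le> card (\<Union>i\<in>{i}. A i)" using hall i by blast
      then have "A i \<noteq> {}" by auto
      then obtain x where x: "x \<in> A i" by blast
      \<comment> \<open>A nonempty \<open>K\<close> that misses \<open>i\<close> is a proper
        subfamily, hence not tight; its strict Hall inequality absorbs the loss of
        \<open>x\<close>.\<close>
      have hall2: "card K \<le> card (\<Union>j\<in>K. A j - {x})" if K: "K \<subseteq> I - {i}" for K
      proof (cases "K = {}")
        case False
        have "finite K" using K finI finite_subset by blast
        then have finAK: "finite (\<Union>j\<in>K. A j)" using K finA by blast
        have "K \<subset> I" using K i by blast
        then have "card (\<Union>j\<in>K. A j) \<noteq> card K" "card K \<le> card (\<Union>j\<in>K. A j)"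
          using hall[of K] no_tight False by blast+
        then have "card K < card (\<Union>j\<in>K. A j)" by linarith
        then have "card K \<le> card ((\<Union>j\<in>K. A j) - {x})"
          using diff_card_le_card_Diff[of "{x}" "\<Union>j\<in>K. A j"] by simp
        also have "(\<Union>j\<in>K. A j) - {x} = (\<Union>j\<in>K. A j - {x})" by blast
        finally show ?thesis .
      qed simp
      have "card (I - {i}) < card I" using i finI by (rule card_Diff1_less[rotated])
      then have "\<exists>h. inj_on h (I - {i}) \<and> (\<forall>j\<in>I - {i}. h j \<in> A j - {x})"
        using less.hyps[of "I - {i}" "\<lambda>j. A j - {x}"] finI finA hall2 by simp
      then obtain h where h: "inj_on h (I - {i})" "\<forall>j\<in>I - {i}. h j \<in> A j - {x}" by blast
      have "inj_on (h(i := x)) I" using h by (auto simp: inj_on_def)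
      moreover have "\<forall>j\<in>I. (h(i := x)) j \<in> A j" using h(2) x by auto
      ultimately show ?thesis by blast
    qed simp
  qed
qed

text \<open>The missing \<open>d\<close> partners are supplied as dummies common to all the sets.\<close>

lemma hall_deficiency:
  fixes A :: "'i \<Rightarrow> 'b set"
  assumes finI: "finite I" and finA: "\<And>i. i \<in> I \<Longrightarrow> finite (A i)"
    and hall: "\<And>J. J \<subseteq> I \<Longrightarrow> card J \<le> card (\<Union>i\<in>J. A i) + d"
  shows "\<exists>U h. U \<subseteq> I \<and> card I \<le> card U + d \<and> inj_on h U \<and> (\<forall>i\<in>U. h i \<in> A i)"
proof -
  define A' :: "'i \<Rightarrow> ('b + nat) set" where "A' = (\<lambda>i. Inl ` A i \<union> Inr ` {..<d})"
  have "card J \<le> card (\<Union>i\<in>J. A' i)" if J: "J \<subseteq> I" for J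
  proof (cases "J = {}")
    case False
    have "finite J" using J finI finite_subset by blast
    then have fin: "finite (\<Union>i\<in>J. A i)" using J finA by blast
    have "(\<Union>i\<in>J. A' i) = (\<Union>i\<in>J. A i) <+> {..<d}" using False by (auto simp: A'_def)
    then show ?thesis using hall[OF J] fin by (simp add: card_Plus)
  qed simp
  then obtain g where g: "inj_on g I" "\<forall>i\<in>I. g i \<in> A' i"
    using hall_marriage[of I A'] finI finA by (auto simp: A'_def)
  define U where "U = {i \<in> I. isl (g i)}"
  define h where "h = projl \<circ> g"
  \<comment> \<open>Indices outside \<open>U\<close> are sent injectively to dummies, so at most
    \<open>d\<close> of them exist.\<close>
  have "inj_on g (I - U)" by (rule inj_on_subset[OF g(1)]) auto
  moreover have "g ` (I - U) \<subseteq> Inr ` {..<d}" using g(2) by (auto simp: U_def A'_def)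
  ultimately have "card (I - U) \<le> card ((Inr :: nat \<Rightarrow> 'b + nat) ` {..<d})"
    by (intro card_inj_on_le) auto
  also have "\<dots> = d" by (simp add: card_image)
  finally have "card I \<le> card U + d"
    using finI by (simp add: U_def card_Diff_subset)
  moreover have "inj_on h U"
    using g(1)
    by (auto simp: inj_on_def h_def U_def intro: sum.expand)
  moreover have "\<forall>i\<in>U. h i \<in> A i" using g(2) by (auto simp: h_def U_def A'_def)
  ultimately show ?thesis by (intro exI[of _ U] exI[of _ h]) (auto simp: U_def)
qed

section \<open>Deficient independent sets\<close>

definition neighbours :: "'v set set \<Rightarrow> 'v \<Rightarrow> 'v set" where
  "neighbours E v = {w. {v, w} \<in> E}"

lemma degree_le_card_neighbours:
  fixes E :: "'v::finite set set"
  assumes "simple_graph E"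
  shows "degree E v \<le> card (neighbours E v)"
proof -
  have "{e \<in> E. v \<in> e} \<subseteq> (\<lambda>w. {v, w}) ` neighbours E v"
  proof
    fix e assume e: "e \<in> {e \<in> E. v \<in> e}"
    then have "card e = 2" using assms by (auto simp: simple_graph_def)
    then obtain w where "e = {v, w}" using e by (auto simp: card_2_iff)
    then show "e \<in> (\<lambda>w. {v, w}) ` neighbours E v" using e by (auto simp: neighbours_def)
  qed
  then have "card {e \<in> E. v \<in> e} \<le> card ((\<lambda>w. {v, w}) ` neighbours E v)"
    by (intro card_mono) auto
  also have "\<dots> \<le> card (neighbours E v)" by (rule card_image_le) simp
  finally show ?thesis by (simp add: degree_def)
qed

text \<open>
  The graph of \<open>h\<close> is a matching in the bipartite double cover; each of its edges contributes
  weight \<open>1/2\<close> to the underlying edge of the graph.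
\<close>

lemma fractional_matching_number_ge_inj:
  fixes E :: "'v::finite set set"
  assumes inj: "inj_on h U" and h: "\<And>u. u \<in> U \<Longrightarrow> h u \<in> neighbours E u"
  shows "real (card U) / 2 \<le> fractional_matching_number E"
proof -
  \<comment> \<open>The fibre \<open>P e\<close> has two elements exactly when \<open>h\<close>
    swaps the ends of \<open>e\<close> within \<open>U\<close>; then \<open>f e = 1\<close>.\<close>
  define P where "P = (\<lambda>e. {u \<in> U. {u, h u} = e})"
  define f where "f = (\<lambda>e. real (card (P e)) / 2)"
  have sum_f: "(\<Sum>e\<in>F. f e) = real (card {u \<in> U. {u, h u} \<in> F}) / 2" for F :: "'v set set"
  proof -
    have "card (\<Union>e\<in>F. P e) = (\<Sum>e\<in>F. card (P e))"
      by (rule card_UN_disjoint) (auto simp: P_def)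
    moreover have "(\<Union>e\<in>F. P e) = {u \<in> U. {u, h u} \<in> F}" by (auto simp: P_def)
    ultimately show ?thesis by (simp add: f_def sum_divide_distrib[symmetric])
  qed
  \<comment> \<open>A vertex \<open>v\<close> meets the matching at most twice: once as a source
    \<open>u = v\<close>, and once as a value \<open>h u = v\<close> by injectivity.\<close>
  have at_vertex: "card {u \<in> U. {u, h u} \<in> {e \<in> E. v \<in> e}} \<le> 2" for v
  proof -
    have "card {u \<in> U. {u, h u} \<in> {e \<in> E. v \<in> e}} \<le> card ({v} \<union> {u \<in> U. h u = v})"
      by (intro card_mono) auto
    also have "\<dots> \<le> card {v} + card {u \<in> U. h u = v}" by (rule card_Un_le)
    also have "card {u \<in> U. h u = v} \<le> card {v}"
      using inj by (intro card_inj_on_le[of h]) (auto simp: inj_on_def)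
    finally show ?thesis by simp
  qed
  have at_vertex_f: "(\<Sum>e\<in>{e \<in> E. v \<in> e}. f e) \<le> 1" for v
    using at_vertex[of v] by (simp add: sum_f)
  have "f e \<le> 1" if "e \<in> E" for e
  proof (cases "P e = {}")
    case False
    then obtain u where "e = {u, h u}" by (auto simp: P_def)
    then have "f e \<le> (\<Sum>e\<in>{e \<in> E. u \<in> e}. f e)"
      using that by (intro member_le_sum) (auto simp: f_def)
    then show ?thesis using at_vertex_f[of u] by linarith
  qed (simp add: f_def)
  then have "fractional_matching E f"
    using at_vertex_f by (auto simp: fractional_matching_def f_def)
  moreover have "(\<Sum>e\<in>E. f e) = real (card U) / 2"
  proof -
    have "{u \<in> U. {u, h u} \<in> E} = U" using h by (auto simp: neighbours_def)
    then show ?thesis by (simp add: sum_f)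
  qed
  ultimately show ?thesis using fractional_matching_number_upper[of E f] by simp
qed

text \<open>If every set had deficiency below \<open>k\<close>, the maximal deficiency
  \<open>d\<close> would be an integer below \<open>k\<close>. Hall's theorem would then give an
  injection on at least \<open>n - d\<close> vertices, hence a fractional matching of weight above
  \<open>(n - k) / 2\<close>.\<close>

lemma deficient_set_exists:
  fixes E :: "'v::finite set set"
  assumes "fractional_matching_number E \<le> (real CARD('v) - k) / 2"
  shows "\<exists>X. real (card (\<Union>v\<in>X. neighbours E v)) + k \<le> real (card X)"
proof (rule ccontr)
  assume neg: "\<not> ?thesis"
  have less: "real (card X) < real (card (\<Union>v\<in>X. neighbours E v)) + k" for X
    using neg by (simp add: not_le)
  define d where "d = Max (range (\<lambda>X. card X - card (\<Union>v\<in>X. neighbours E v)))"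
  have "card X - card (\<Union>v\<in>X. neighbours E v) \<le> d" for X
    unfolding d_def by (rule Max_ge) auto
  then have "card X \<le> card (\<Union>v\<in>X. neighbours E v) + d" for X
    by (simp add: le_diff_conv add.commute)
  then obtain U h where U: "CARD('v) \<le> card U + d" "inj_on h U" "\<forall>u\<in>U. h u \<in> neighbours E u"
    using hall_deficiency[of UNIV "neighbours E" d] by auto
  have "d \<in> range (\<lambda>X. card X - card (\<Union>v\<in>X. neighbours E v))"
    unfolding d_def by (rule Max_in) auto
  then obtain X where "d = card X - card (\<Union>v\<in>X. neighbours E v)" by blast
  \<comment> \<open>Subtraction in \<open>d\<close> is truncated at 0, so positivity of
    \<open>k\<close> covers the case \<open>d = 0\<close>.\<close>
  moreover have "0 < k" using less[of "{}"] by simp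
  ultimately have "real d < k" using less[of X] by linarith
  moreover have "real (card U) / 2 \<le> fractional_matching_number E"
    using U by (intro fractional_matching_number_ge_inj) auto
  moreover have "real CARD('v) \<le> real (card U) + real d"
    using U(1) by (simp flip: of_nat_add)
  ultimately show False using assms by argo
qed

text \<open>With \<open>N = N(X)\<close> and \<open>T = X - N\<close>, a neighbour of
  \<open>T\<close> lies in \<open>N\<close> but not in \<open>X\<close>, as otherwise its neighbour
  in \<open>T\<close> would lie in \<open>N\<close>. Passing to \<open>T\<close> thus removes
  \<open>card (N \<inter> X)\<close> from \<open>card X\<close> and at least as much from
  \<open>card N\<close>, so the deficiency survives.\<close>

lemma deficient_independent_set_exists:
  fixes E :: "'v::finite set set"
  assumes "fractional_matching_number E \<le> (real CARD('v) - k) / 2"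
  shows "\<exists>T. (\<forall>u\<in>T. \<forall>v\<in>T. {u, v} \<notin> E) \<and>
    real (card (\<Union>v\<in>T. neighbours E v)) + k \<le> real (card T)"
proof -
  obtain X where X: "real (card (\<Union>v\<in>X. neighbours E v)) + k \<le> real (card X)"
    using deficient_set_exists[OF assms] by blast
  define N where "N = (\<Union>v\<in>X. neighbours E v)"
  define T where "T = X - N"
  have "(\<Union>v\<in>T. neighbours E v) \<subseteq> N - X"
    by (auto simp: T_def N_def neighbours_def insert_commute)
  then have "card (\<Union>v\<in>T. neighbours E v) \<le> card (N - X)" by (intro card_mono) auto
  moreover have "card (N - X) + card (N \<inter> X) = card N" "card T + card (N \<inter> X) = card X"
    unfolding T_def
    by (metis add.commute card_Int_Diff[of N X] finite,
        metis add.commute card_Int_Diff[of X N] finite Int_commute)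
  moreover have "\<forall>u\<in>T. \<forall>v\<in>T. {u, v} \<notin> E" by (auto simp: T_def N_def neighbours_def)
  ultimately show ?thesis using X by (intro exI[of _ T]) (simp flip: N_def)
qed

section \<open>The largest eigenvalue\<close>

text \<open>By compactness the quadratic form attains its maximum \<open>m\<close> on the unit
  sphere. A perturbation argument shows that the maximiser is an eigenvector, so \<open>m\<close> is
  an eigenvalue and at most \<open>lambda1 M\<close>.\<close>

lemma rayleigh_le_lambda1:
  fixes M :: "real ^ 'v ^ 'v::finite"
  assumes sym: "transpose M = M"
  shows "y \<bullet> (M *v y) \<le> lambda1 M * (y \<bullet> y)"
proof -
  have self_adjoint: "(M *v u) \<bullet> v = u \<bullet> (M *v v)" for u v
    by (metis sym dot_lmul_matrix transpose_matrix_vector)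
  have cont: "continuous_on (sphere 0 1) (\<lambda>x. x \<bullet> (M *v x))"
    by (intro continuous_intros)
  have "sphere (0 :: real ^ 'v) 1 \<noteq> {}" by simp
  then obtain x where x: "norm x = 1"
    and mx: "\<And>y. norm y = 1 \<Longrightarrow> y \<bullet> (M *v y) \<le> x \<bullet> (M *v x)"
    using continuous_attains_sup[OF compact_sphere _ cont] by (auto simp: dist_norm)
  define m where "m = x \<bullet> (M *v x)"
  have bound: "y \<bullet> (M *v y) \<le> m * (y \<bullet> y)" for y
  proof (cases "y = 0")
    case False
    define z where "z = y /\<^sub>R norm y"
    have y: "y = norm y *\<^sub>R z" and "norm z = 1" using False by (auto simp: z_def)
    then have "(norm y)\<^sup>2 * (z \<bullet> (M *v z)) \<le> (norm y)\<^sup>2 * m"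
      using mx by (intro mult_left_mono) (auto simp: m_def)
    moreover have "y \<bullet> (M *v y) = (norm y)\<^sup>2 * (z \<bullet> (M *v z))"
      by (subst (1 2) y) (simp add: matrix_vector_mult_scaleR power2_eq_square)
    ultimately show ?thesis by (simp add: dot_square_norm mult.commute)
  qed simp
  define z where "z = M *v x - m *\<^sub>R x"
  define c where "c = m * (z \<bullet> z) - z \<bullet> (M *v z)"
  have c: "0 \<le> c" using bound[of z] by (simp add: c_def)
  \<comment> \<open>Moving from \<open>x\<close> in the direction of the residual \<open>z\<close>
    gains \<open>2 * s * (z \<bullet> z)\<close> to first order, which maximality of
    \<open>m\<close> forces below the second-order term.\<close>
  have ineq: "2 * s * (z \<bullet> z) \<le> s\<^sup>2 * c" for s
  proof -
    have xx: "x \<bullet> x = 1" using x by (simp add: dot_square_norm)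
    have Mx: "M *v x = z + m *\<^sub>R x" by (simp add: z_def)
    have zMx: "z \<bullet> (M *v x) = z \<bullet> z + m * (x \<bullet> z)"
      by (simp add: Mx inner_add_right inner_commute)
    then have xMz: "x \<bullet> (M *v z) = z \<bullet> z + m * (x \<bullet> z)"
      by (metis inner_commute self_adjoint)
    show ?thesis
      using bound[of "x + s *\<^sub>R z"] xx
      by (simp add: matrix_vector_right_distrib matrix_vector_mult_scaleR inner_add_left
          inner_add_right zMx xMz m_def[symmetric] c_def inner_commute[of z x] power2_eq_square
          algebra_simps)
  qed
  have "z = 0"
  proof (rule ccontr)
    assume "z \<noteq> 0"
    then have zz: "z \<bullet> z > 0" by simp
    \<comment> \<open>A step small enough for the linear term to win; \<open>c + 1\<close> avoids
      division by zero when \<open>c = 0\<close>.\<close>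
    define s where "s = (z \<bullet> z) / (c + 1)"
    have s: "s > 0" using zz c by (simp add: s_def)
    have "s * c \<le> z \<bullet> z" using zz c by (simp add: s_def field_simps)
    then have "s * (s * c) \<le> s * (z \<bullet> z)" using s by simp
    moreover have "0 < s * (z \<bullet> z)" using s zz by simp
    ultimately show False using ineq[of s] by (simp add: power2_eq_square)
  qed
  then have "M *v x = m *\<^sub>R x" by (simp add: z_def)
  moreover have "x \<noteq> 0" using x by auto
  ultimately have "m \<in> eigenvalues M" by (auto simp: eigenvalues_def)
  then have "m \<le> lambda1 M"
    unfolding lambda1_def using finite_eigenvalues[OF sym] by simp
  then have "m * (y \<bullet> y) \<le> lambda1 M * (y \<bullet> y)" by (intro mult_right_mono) auto
  then show ?thesis using bound[of y] by linarith
qed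

text \<open>The Rayleigh quotient of the indicator vector of \<open>T\<close> is the average over
  \<open>i \<in> T\<close> of the row sums of \<open>M\<close> restricted to \<open>T\<close>. In
  each row the diagonal gives at least \<open>a * (card T - 1)\<close>, since the clique edges at
  \<open>i\<close> bound its degree from below, and the adjacency part gives at least
  \<open>card T - 1\<close>.\<close>

lemma lambda1_clique_ge:
  fixes E :: "'v::finite set set"
  assumes a: "0 \<le> a" and ne: "T \<noteq> {}"
    and clique: "\<And>u v. u \<in> T \<Longrightarrow> v \<in> T \<Longrightarrow> u \<noteq> v \<Longrightarrow> {u, v} \<in> E"
  shows "(a + 1) * (real (card T) - 1) \<le> lambda1 (a *\<^sub>R degree_matrix E + adjacency_matrix E)"
proof -
  define M where "M = a *\<^sub>R degree_matrix E + adjacency_matrix E"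
  define x :: "real ^ 'v" where "x = (\<chi> i. indicator T i)"
  have restrict: "(\<Sum>i\<in>UNIV. indicator T i * g i) = (\<Sum>i\<in>T. g i)" for g :: "'v \<Rightarrow> real"
    by (simp add: indicator_def sum.If_cases if_distrib[of "\<lambda>c. c * _"] cong: if_cong)
  then have restrict': "(\<Sum>i\<in>UNIV. g i * indicator T i) = (\<Sum>i\<in>T. g i)" for g :: "'v \<Rightarrow> real"
    by (simp add: mult.commute)
  have row: "(a + 1) * (real (card T) - 1) \<le> (\<Sum>j\<in>T. M $ i $ j)" if i: "i \<in> T" for i
  proof -
    have card1: "real (card (T - {i})) = real (card T) - 1"
      using i by (simp add: card_Diff_singleton of_nat_diff card_gt_0_iff Suc_leI ne)
    have "card ((\<lambda>w. {i, w}) ` (T - {i})) \<le> card {e \<in> E. i \<in> e}"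
      using i clique by (intro card_mono) auto
    moreover have "inj_on (\<lambda>w. {i, w}) (T - {i})" by (auto simp: inj_on_def doubleton_eq_iff)
    ultimately have "real (card T) - 1 \<le> real (degree E i)"
      using card1 by (simp add: card_image degree_def)
    then have "a * (real (card T) - 1) \<le> a * real (degree E i)"
      using a by (intro mult_left_mono)
    moreover have "(\<Sum>j\<in>T. degree_matrix E $ i $ j) = real (degree E i)"
      using i by (simp add: degree_matrix_def)
    moreover have "real (card T) - 1 \<le> (\<Sum>j\<in>T. adjacency_matrix E $ i $ j)"
    proof -
      have "(\<Sum>j\<in>T - {i}. adjacency_matrix E $ i $ j) = (\<Sum>j\<in>T - {i}. 1)"
        using i clique by (intro sum.cong) (auto simp: adjacency_matrix_def)
      then have "real (card T) - 1 = (\<Sum>j\<in>T - {i}. adjacency_matrix E $ i $ j)"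
        using card1 by simp
      also have "\<dots> \<le> (\<Sum>j\<in>T. adjacency_matrix E $ i $ j)"
        by (intro sum_mono2) (auto simp: adjacency_matrix_def)
      finally show ?thesis .
    qed
    ultimately show ?thesis
      by (simp add: M_def sum.distrib sum_distrib_left[symmetric] algebra_simps)
  qed
  have "x \<bullet> (M *v x) = (\<Sum>i\<in>T. \<Sum>j\<in>T. M $ i $ j)"
    by (simp add: x_def inner_vec_def matrix_vector_mult_def restrict restrict')
  moreover have "x \<bullet> x = real (card T)"
    by (simp add: x_def inner_vec_def restrict)
  moreover have "(\<Sum>i\<in>T. (a + 1) * (real (card T) - 1)) \<le> (\<Sum>i\<in>T. \<Sum>j\<in>T. M $ i $ j)"
    using row by (intro sum_mono)
  ultimately have "real (card T) * ((a + 1) * (real (card T) - 1)) \<le> real (card T) * lambda1 M"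
    using rayleigh_le_lambda1[of M x] by (simp add: M_def transpose_degree_adjacency mult.commute)
  moreover have "0 < real (card T)" using ne by (simp add: card_gt_0_iff)
  ultimately show ?thesis by (simp add: M_def)
qed

theorem theorem1p4:
  fixes E :: "'v::finite set set" and a k :: real
  assumes "a \<ge> 0"
    and "simple_graph E"
    and "connected_graph E"
    and "0 < k" and "k < real CARD('v)"
    and "real (min_degree E) \<le> (real CARD('v) - k) / 2"
    and "lambda1 (a *\<^sub>R degree_matrix (complement_graph E) + adjacency_matrix (complement_graph E))
           < (a + 1) * (real (min_degree E) + k - 1)"
  shows "fractional_matching_number E > (real CARD('v) - k) / 2"
proof (rule ccontr)
  assume "\<not> ?thesis"
  then obtain T where indep: "\<forall>u\<in>T. \<forall>v\<in>T. {u, v} \<notin> E"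
    and T: "real (card (\<Union>v\<in>T. neighbours E v)) + k \<le> real (card T)"
    using deficient_independent_set_exists[of E k] by auto
  have "T \<noteq> {}" using T \<open>0 < k\<close> by auto
  then obtain t where t: "t \<in> T" by blast
  have "min_degree E \<le> degree E t" by (simp add: min_degree_def)
  also have "\<dots> \<le> card (neighbours E t)"
    using \<open>simple_graph E\<close> by (rule degree_le_card_neighbours)
  also have "\<dots> \<le> card (\<Union>v\<in>T. neighbours E v)" using t by (intro card_mono) auto
  finally have "real (min_degree E) + k - 1 \<le> real (card T) - 1" using T by linarith
  then have "(a + 1) * (real (min_degree E) + k - 1) \<le> (a + 1) * (real (card T) - 1)"
    using \<open>a \<ge> 0\<close> by (intro mult_left_mono) auto
  also have "\<dots> \<le> lambda1 (a *\<^sub>R degree_matrix (complement_graph E)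
      + adjacency_matrix (complement_graph E))"
    using \<open>a \<ge> 0\<close> \<open>T \<noteq> {}\<close> indep
    by (intro lambda1_clique_ge) (auto simp: complement_graph_def)
  finally show False using assms(7) by linarith
qed

end
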